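(* Let $n \geqslant 1$ be an integer, let $v_1, \dots, v_n > 0$ be real numbers, and let $\bar{v} = \frac{1}{n} \sum_{i=1}^n v_i$. Let $X_1, \dots, X_n$ be independent real random variables such that, for every $i \in \{1,\dots,n\}$, $X_i$ is uniformly distributed on the interval $[-v_i, v_i]$. For $\lambda, t > 0$ define $$\psi(\lambda,t) = -\lambda t + \lambda n \bar{v} + n \log \left( \frac{1- e^{-2\lambda \bar{v}}}{2 \lambda \bar{v}} \right) + \lambda \sum_{i=1}^n \left| v_i - \bar{v} \right|.$$ Then, for all $t > 0$ and every $\lambda_0 > 0$ such that $\frac{\partial \psi}{\partial \lambda}(\lambda_0,t) = 0$, $$\mathbb{P}\left( \left| \sum_{i=1}^n X_i \right| \geqslant t \right) \leqslant 2 \exp \left( \psi(\lambda_0,t) \right).$$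
   Context: $\log$ denotes the natural logarithm. *)

theory Defs
  imports "HOL-Probability.Probability"
begin

definition vbar :: "nat \<Rightarrow> (nat \<Rightarrow> real) \<Rightarrow> real" where
  "vbar n v = (1 / real n) * (\<Sum>i=1..n. v i)"

(* Only meaningful for n > 0, v i > 0 (1 \<le> i \<le> n) and lam, t > 0; elsewhere the value is
   an artefact of totality. *)
definition psi :: "nat \<Rightarrow> (nat \<Rightarrow> real) \<Rightarrow> real \<Rightarrow> real \<Rightarrow> real" where
  "psi n v lam t =
     - lam * t + lam * real n * vbar n v
     + real n * ln ((1 - exp (- 2 * lam * vbar n v)) / (2 * lam * vbar n v))
     + lam * (\<Sum>i=1..n. \<bar>v i - vbar n v\<bar>)"

end

theory Submission
  imports Defs
begin

text \<open>
  By independence the moment generating function of the sum at \<open>s \<noteq> 0\<close> is the product of the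
  factors \<open>sinh (s v\<^sub>i) / (s v\<^sub>i)\<close>, and the Chernoff bound applies at \<open>s = \<plusminus>\<lambda>\<^sub>0\<close>. The function
  \<open>g x = ln (sinh x / x)\<close> has derivative \<open>coth x - 1 / x \<in> [0, 1]\<close> on the positive half-line, so it
  is 1-Lipschitz there and \<open>g (\<lambda> v\<^sub>i) \<le> g (\<lambda> v\<^sub>m) + \<lambda> \<bar>v\<^sub>i - v\<^sub>m\<bar>\<close>, where \<open>v\<^sub>m\<close> is the mean of the
  \<open>v\<^sub>i\<close>. Summing over \<open>i\<close> gives \<open>\<psi>\<close>.
\<close>

lemma sinh_div_self_pos:
  fixes x :: real
  assumes "x \<noteq> 0"
  shows "sinh x / x > 0"
  using assms by (cases "x > 0") (auto simp: divide_pos_pos divide_neg_neg)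

text \<open>With \<open>x = lam * vbar n v\<close>, the last factor is the argument of
  \<open>ln\<close> in \<open>psi\<close>, so this identity links \<open>psi\<close> to the moment
  generating functions.\<close>

lemma sinh_div_self_eq:
  fixes x :: real
  shows "sinh x / x = exp x * ((1 - exp (- 2 * x)) / (2 * x))"
proof -
  have "exp x * exp (- 2 * x) = exp (- x)"
    by (simp flip: exp_add)
  then have "sinh x = exp x * (1 - exp (- 2 * x)) / 2"
    by (simp only: sinh_field_def right_diff_distrib mult_1_right)
  then show ?thesis by (simp only: times_divide_eq_right divide_divide_eq_left)
qed

text \<open>The difference \<open>x * cosh x - sinh x\<close> vanishes at 0 and has derivative
  \<open>x * sinh x\<close>; it is the numerator of the derivative of
  \<open>sinh x / x\<close>.\<close>

lemma sinh_le_mult_cosh: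
  fixes x :: real
  assumes "x \<ge> 0"
  shows "sinh x \<le> x * cosh x"
proof -
  have "0 * cosh 0 - sinh 0 \<le> x * cosh x - sinh x"
  proof (rule DERIV_nonneg_imp_nondecreasing[OF assms, where f = "\<lambda>x. x * cosh x - sinh x"])
    fix y :: real
    assume "0 \<le> y"
    have "((\<lambda>x. x * cosh x - sinh x) has_real_derivative y * sinh y) (at y)"
      by (auto intro!: derivative_eq_intros)
    with \<open>0 \<le> y\<close> show "\<exists>d. ((\<lambda>x. x * cosh x - sinh x) has_real_derivative d) (at y) \<and> d \<ge> 0"
      by (intro exI[of _ "y * sinh y"]) auto
  qed
  then show ?thesis by simp
qed

text \<open>The bound \<open>g' \<ge> 0\<close>, stated for \<open>exp (g x)\<close> so that no
  logarithm occurs.\<close>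

lemma sinh_div_self_mono:
  fixes x y :: real
  assumes "0 < x" "x \<le> y"
  shows "sinh x / x \<le> sinh y / y"
proof (rule DERIV_nonneg_imp_nondecreasing[OF assms(2), where f = "\<lambda>x. sinh x / x"])
  fix z assume "x \<le> z"
  with assms have z: "z > 0" by simp
  have "((\<lambda>x. sinh x / x) has_real_derivative (cosh z * z - sinh z) / (z * z)) (at z)"
    using z by (auto intro!: derivative_eq_intros)
  then show "\<exists>d. ((\<lambda>x. sinh x / x) has_real_derivative d) (at z) \<and> d \<ge> 0"
    using sinh_le_mult_cosh[of z] z by (auto intro!: exI simp: mult.commute)
qed

text \<open>The bound \<open>g' \<le> 1\<close>: the function is \<open>exp (g x - x)\<close>, and
  the sign of its derivative comes down to \<open>1 + u \<le> exp u\<close>.\<close>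

lemma exp_mult_sinh_div_self_antimono:
  fixes x y :: real
  assumes "0 < x" "x \<le> y"
  shows "exp (- y) * (sinh y / y) \<le> exp (- x) * (sinh x / x)"
proof -
  have eq: "exp (- z) * (sinh z / z) = (1 - exp (- 2 * z)) / (2 * z)" for z :: real
    by (simp add: sinh_div_self_eq exp_minus)
  have "(1 - exp (- 2 * y)) / (2 * y) \<le> (1 - exp (- 2 * x)) / (2 * x)"
  proof (rule DERIV_nonpos_imp_nonincreasing[OF assms(2), where f = "\<lambda>x. (1 - exp (- 2 * x)) / (2 * x)"])
    fix z assume "x \<le> z"
    with assms have z: "z > 0" by simp
    let ?d = "((1 + 2 * z) * exp (- 2 * z) - 1) / (2 * z\<^sup>2)"
    have "((\<lambda>x. (1 - exp (- 2 * x)) / (2 * x)) has_real_derivative ?d) (at z)"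
      using z by (auto intro!: derivative_eq_intros simp: field_simps power2_eq_square)
    \<comment> \<open>The right-hand side equals 1, so this says that the numerator of
      \<open>?d\<close> is at most 0.\<close>
    moreover have "(1 + 2 * z) * exp (- 2 * z) \<le> exp (2 * z) * exp (- 2 * z)"
      by (intro mult_right_mono exp_ge_add_one_self) auto
    then have "?d \<le> 0"
      using z by (intro divide_nonpos_pos) (auto simp flip: exp_add)
    ultimately show "\<exists>d. ((\<lambda>x. (1 - exp (- 2 * x)) / (2 * x)) has_real_derivative d) (at z) \<and> d \<le> 0"
      by blast
  qed
  then show ?thesis unfolding eq .
qed

text \<open>The Lipschitz bound after exponentiation. For \<open>x \<le> y\<close> it is the
  antitone estimate; otherwise monotonicity suffices, since the exponential factor is at least
  1.\<close>

lemma sinh_div_self_le_exp_abs_diff: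
  fixes x y :: real
  assumes "0 < x" "0 < y"
  shows "sinh y / y \<le> exp \<bar>y - x\<bar> * (sinh x / x)"
proof (cases "x \<le> y")
  case True
  have "sinh y / y = exp y * (exp (- y) * (sinh y / y))"
    by (simp add: exp_minus)
  also have "\<dots> \<le> exp y * (exp (- x) * (sinh x / x))"
    using exp_mult_sinh_div_self_antimono[OF assms(1) True] by (intro mult_left_mono) auto
  also have "\<dots> = exp \<bar>y - x\<bar> * (sinh x / x)"
    using True by (simp add: exp_diff exp_minus divide_inverse)
  finally show ?thesis .
next
  case False
  have "sinh y / y \<le> 1 * (sinh x / x)"
    using False sinh_div_self_mono[OF assms(2), of x] by simp
  also have "\<dots> \<le> exp \<bar>y - x\<bar> * (sinh x / x)"
    using sinh_div_self_pos[of x] assms by (intro mult_right_mono) auto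
  finally show ?thesis .
qed

text \<open>At \<open>s = 0\<close> the expectation is 1 while the quotient is 0 by the convention
  for division, hence \<open>s \<noteq> 0\<close>.\<close>

lemma (in prob_space) uniform_distributed_mgf:
  fixes v s :: real
  assumes "v > 0" "s \<noteq> 0"
    and D: "distributed M lborel X (\<lambda>x. indicator {- v..v} x / measure lborel {- v..v})"
  shows "integrable M (\<lambda>\<omega>. exp (s * X \<omega>))"
    and "expectation (\<lambda>\<omega>. exp (s * X \<omega>)) = sinh (s * v) / (s * v)"
proof -
  \<comment> \<open>An antiderivative of \<open>exp (s * x)\<close> times the density
    \<open>1 / (2 * v)\<close>.\<close>
  let ?F = "\<lambda>x. exp (s * x) / (2 * v * s)"
  have "has_bochner_integral lborel (\<lambda>x. exp (s * x) / (2 * v) * indicator {- v..v} x) (?F v - ?F (- v))"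
    using assms by (intro has_bochner_integral_FTC_Icc_real)
      (auto intro!: derivative_eq_intros continuous_intros)
  moreover have "?F v - ?F (- v) = sinh (s * v) / (s * v)"
    using assms by (simp add: sinh_field_def field_simps)
  moreover have "(\<lambda>x. exp (s * x) / (2 * v) * indicator {- v..v} x) =
      (\<lambda>x. indicator {- v..v} x / measure lborel {- v..v} * exp (s * x))"
    using assms by auto
  ultimately have "has_bochner_integral lborel
      (\<lambda>x. indicator {- v..v} x / measure lborel {- v..v} * exp (s * x)) (sinh (s * v) / (s * v))"
    by simp
  then show "integrable M (\<lambda>\<omega>. exp (s * X \<omega>))"
    and "expectation (\<lambda>\<omega>. exp (s * X \<omega>)) = sinh (s * v) / (s * v)"
    using distributed_integrable[OF D, of "\<lambda>x. exp (s * x)"]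
      distributed_integral[OF D, of "\<lambda>x. exp (s * x)"]
    \<comment> \<open>The interval length stays unevaluated so that the integrand still matches the
      density in \<open>D\<close>.\<close>
    by (auto simp: has_bochner_integral_iff simp del: content_real_if)
qed

text \<open>The sign of \<open>s\<close> is free, so both tails are covered. The threshold
  \<open>t\<close> applies to the scaled sum, which is why the prefactor is
  \<open>exp (- t)\<close>.\<close>

lemma (in prob_space) Chernoff_sum_uniform:
  fixes v :: "'i \<Rightarrow> real" and s t :: real
  assumes "finite I" "\<And>i. i \<in> I \<Longrightarrow> v i > 0"
    and indep: "indep_vars (\<lambda>_. borel) X I"
    and D: "\<And>i. i \<in> I \<Longrightarrow>
      distributed M lborel (X i) (\<lambda>x. indicator {- v i..v i} x / measure lborel {- v i..v i})"
    and "s \<noteq> 0"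
  shows "prob {\<omega> \<in> space M. t \<le> s * (\<Sum>i\<in>I. X i \<omega>)} \<le> exp (- t) * (\<Prod>i\<in>I. sinh (s * v i) / (s * v i))"
proof -
  have indep': "indep_vars (\<lambda>_. borel) (\<lambda>i \<omega>. exp (s * X i \<omega>)) I"
    by (rule indep_vars_compose2[OF indep]) auto
  note mgf = uniform_distributed_mgf[OF assms(2) \<open>s \<noteq> 0\<close> D]
  have exp_sum': "exp (s * (\<Sum>i\<in>I. X i \<omega>)) = (\<Prod>i\<in>I. exp (s * X i \<omega>))" for \<omega>
    using assms(1) by (simp add: sum_distrib_left exp_sum)
  have int: "integrable M (\<lambda>\<omega>. exp (s * (\<Sum>i\<in>I. X i \<omega>)))"
    unfolding exp_sum' by (intro indep_vars_integrable assms(1) indep' mgf)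
  have "prob {\<omega> \<in> space M. t \<le> s * (\<Sum>i\<in>I. X i \<omega>)} =
      prob {\<omega> \<in> space M. exp t \<le> exp (s * (\<Sum>i\<in>I. X i \<omega>))}"
    by simp
  also have "\<dots> \<le> expectation (\<lambda>\<omega>. exp (s * (\<Sum>i\<in>I. X i \<omega>))) / exp t"
    by (rule integral_Markov_inequality_measure[OF int sets.top]) auto
  also have "expectation (\<lambda>\<omega>. exp (s * (\<Sum>i\<in>I. X i \<omega>))) =
      (\<Prod>i\<in>I. expectation (\<lambda>\<omega>. exp (s * X i \<omega>)))"
    unfolding exp_sum' by (intro indep_vars_lebesgue_integral assms(1) indep' mgf)
  also have "\<dots> = (\<Prod>i\<in>I. sinh (s * v i) / (s * v i))"
    by (intro prod.cong refl mgf)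
  finally show ?thesis by (simp add: exp_minus divide_inverse mult.commute)
qed

text \<open>Puts the target bound in product form, ready to be compared factor by factor with the
  product in the Chernoff bound.\<close>

lemma exp_psi:
  assumes "vbar n v > 0" "lam > 0"
  shows "exp (psi n v lam t) = exp (- (lam * t)) *
    (\<Prod>i=1..n. exp \<bar>lam * v i - lam * vbar n v\<bar> * (sinh (lam * vbar n v) / (lam * vbar n v)))"
proof -
  define x where "x = lam * vbar n v"
  have x: "x > 0" using assms by (simp add: x_def)
  have "(1 - exp (- 2 * x)) / (2 * x) > 0" using x by simp
  then have "exp (real n * ln ((1 - exp (- 2 * x)) / (2 * x))) = ((1 - exp (- 2 * x)) / (2 * x)) ^ n"
    by (simp only: exp_of_nat_mult exp_ln)
  then have "exp (real n * x + real n * ln ((1 - exp (- 2 * x)) / (2 * x)))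
      = (exp x * ((1 - exp (- 2 * x)) / (2 * x))) ^ n"
    by (simp only: exp_add exp_of_nat_mult power_mult_distrib)
  also note sinh_div_self_eq[symmetric]
  finally have sinh_pow: "exp (real n * x + real n * ln ((1 - exp (- 2 * x)) / (2 * x))) = (sinh x / x) ^ n" .
  have abs_sum: "lam * (\<Sum>i=1..n. \<bar>v i - vbar n v\<bar>) = (\<Sum>i=1..n. \<bar>lam * v i - x\<bar>)"
    using assms by (simp add: x_def sum_distrib_left abs_mult flip: right_diff_distrib)
  \<comment> \<open>The grouping keeps the argument of \<open>exp\<close> in \<open>sinh_pow\<close>
    together when the exponential of the sum is split.\<close>
  have "psi n v lam t = - (lam * t) + ((real n * x + real n * ln ((1 - exp (- 2 * x)) / (2 * x)))
      + (\<Sum>i=1..n. \<bar>lam * v i - x\<bar>))"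
    unfolding psi_def abs_sum by (simp add: x_def algebra_simps)
  then have "exp (psi n v lam t) =
      exp (- (lam * t)) * ((sinh x / x) ^ n * exp (\<Sum>i=1..n. \<bar>lam * v i - x\<bar>))"
    by (simp only: exp_add[of "- (lam * t)"] exp_add[of _ "\<Sum>i=1..n. \<bar>lam * v i - x\<bar>"] sinh_pow)
  then show ?thesis
    by (simp add: exp_sum prod.distrib mult.commute x_def del: times_divide_eq_right times_divide_eq_left)
qed

theorem proposition3:
  fixes n :: nat and v :: "nat \<Rightarrow> real"
    and M :: "'a measure" and X :: "nat \<Rightarrow> 'a \<Rightarrow> real"
    and t lam0 :: real
  assumes "n \<ge> 1"
    and "\<And>i. i \<in> {1..n} \<Longrightarrow> v i > 0"
    and "prob_space M"
    and "prob_space.indep_vars M (\<lambda>_. borel) X {1..n}"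
    and "\<And>i. i \<in> {1..n} \<Longrightarrow>
           distributed M lborel (X i)
             (\<lambda>x. indicator {- v i..v i} x / measure lborel {- v i..v i})"
    and "t > 0"
    and "lam0 > 0"
    and "((\<lambda>lam. psi n v lam t) has_real_derivative 0) (at lam0)"
  shows "measure M {\<omega> \<in> space M. \<bar>\<Sum>i=1..n. X i \<omega>\<bar> \<ge> t} \<le> 2 * exp (psi n v lam0 t)"
proof -
  interpret prob_space M by fact
  have "(\<Sum>i=1..n. v i) > 0"
    using assms(1,2) by (intro sum_pos) auto
  then have vbar: "vbar n v > 0"
    using assms(1) by (simp add: vbar_def)
  let ?S = "\<lambda>\<omega>. \<Sum>i=1..n. X i \<omega>"
  have "?S \<in> borel_measurable M"
    using assms(4) by (intro borel_measurable_sum) (auto simp: indep_vars_def2)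
  then have "(\<lambda>\<omega>. s * ?S \<omega>) \<in> borel_measurable M" for s
    by (intro borel_measurable_times borel_measurable_const)
  then have event: "{\<omega> \<in> space M. lam0 * t \<le> s * ?S \<omega>} \<in> events" for s
    unfolding borel_measurable_iff_ge by blast
  \<comment> \<open>The choice \<open>s = - lam0\<close> gives the lower tail, where the sum is at
    most \<open>- t\<close>.\<close>
  have tail: "prob {\<omega> \<in> space M. lam0 * t \<le> s * ?S \<omega>} \<le> exp (psi n v lam0 t)"
    if s: "s \<in> {lam0, - lam0}" for s
  proof -
    have "prob {\<omega> \<in> space M. lam0 * t \<le> s * ?S \<omega>} \<le>
        exp (- (lam0 * t)) * (\<Prod>i=1..n. sinh (s * v i) / (s * v i))"
      using assms s by (intro Chernoff_sum_uniform) auto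
    also have "\<dots> \<le> exp (psi n v lam0 t)"
      unfolding exp_psi[OF vbar \<open>lam0 > 0\<close>]
    proof (intro mult_left_mono prod_mono conjI)
      fix i assume i: "i \<in> {1..n}"
      \<comment> \<open>The function \<open>sinh x / x\<close> is even, so both signs of
        \<open>s\<close> lead to the same bound.\<close>
      have "sinh (s * v i) / (s * v i) = sinh (lam0 * v i) / (lam0 * v i)"
        using s by auto
      then show "sinh (s * v i) / (s * v i)
          \<le> exp \<bar>lam0 * v i - lam0 * vbar n v\<bar> * (sinh (lam0 * vbar n v) / (lam0 * vbar n v))"
        using assms(2)[OF i] \<open>lam0 > 0\<close> vbar
        by (simp only:) (intro sinh_div_self_le_exp_abs_diff mult_pos_pos)
      have "s * v i \<noteq> 0"
        using assms(2)[OF i] \<open>lam0 > 0\<close> s by auto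
      then show "0 \<le> sinh (s * v i) / (s * v i)"
        by (intro less_imp_le sinh_div_self_pos)
    qed simp
    finally show ?thesis .
  qed
  \<comment> \<open>Scaling by \<open>lam0 > 0\<close> preserves the order and turns the two-sided
    event into the union of the two events bounded by \<open>tail\<close>.\<close>
  have abs_iff: "t \<le> \<bar>y\<bar> \<longleftrightarrow> lam0 * t \<le> lam0 * y \<or> lam0 * t \<le> - lam0 * y" for y
    using mult_le_cancel_left_pos[OF \<open>lam0 > 0\<close>, of t y]
      mult_le_cancel_left_pos[OF \<open>lam0 > 0\<close>, of t "- y"] by (auto simp: abs_if)
  have split: "{\<omega> \<in> space M. \<bar>?S \<omega>\<bar> \<ge> t} =
      {\<omega> \<in> space M. lam0 * t \<le> lam0 * ?S \<omega>} \<union> {\<omega> \<in> space M. lam0 * t \<le> - lam0 * ?S \<omega>}"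
    unfolding abs_iff by blast
  have "prob {\<omega> \<in> space M. \<bar>?S \<omega>\<bar> \<ge> t} \<le> prob {\<omega> \<in> space M. lam0 * t \<le> lam0 * ?S \<omega>}
      + prob {\<omega> \<in> space M. lam0 * t \<le> - lam0 * ?S \<omega>}"
    unfolding split by (intro measure_Un_le event)
  also have "\<dots> \<le> exp (psi n v lam0 t) + exp (psi n v lam0 t)"
    by (intro add_mono tail) simp_all
  finally show ?thesis by (simp only: mult_2)
qed

end
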